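(* Let $(M,g,f,\lambda)$ be a gradient Yamabe soliton of dimension $n\ge 2$ which is expanding or steady (i.e. $\lambda<0$ or $\lambda=0$), with non-negative scalar curvature. Let $q\in M$ and $r>0$, and let $B(q,r)$ be the ball of radius $r$ centered at $q$. If the potential function $f$ satisfies $$\int_{M-B(q,r)}\frac{f}{d(x,q)^{2}} < \infty,$$ then $f$ is subharmonic, i.e. $\Delta f\ge 0$ on $M$.
   Context: A gradient Yamabe soliton $(M,g,f,\lambda)$ of dimension $n$ ($n\ge 2$) is a connected Riemannian manifold $(M,g)$ of dimension $n$ together with a constant $\lambda\in\mathbb{R}$ and a smooth function $f:M\to\mathbb{R}$ (the potential function) such that $\nabla^2 f=(R-\lambda)g$, where $\nabla^2 f$ is the Hessian of $f$ and $R$ is the scalar curvature of $(M,g)$. It is called shrinking, steady or expanding if $\lambda>0$, $\lambda=0$ or $\lambda<0$, respectively. $\Delta f$ is the trace of $\nabla^2 f$ with respect to $g$, $d$ is the Riemannian distance, and integrals are taken in $x$ with respect to the Riemannian volume. *)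

theory Defs
  imports "HOL-Analysis.Analysis"
begin

section \<open>Smooth maps between open subsets of normed spaces\<close>

text \<open>Only meaningful for open \<open>S\<close>.\<close>

primrec Ck_on :: "nat \<Rightarrow> 'a::real_normed_vector set \<Rightarrow> ('a \<Rightarrow> 'b::real_normed_vector) \<Rightarrow> bool" where
  "Ck_on 0 S h \<longleftrightarrow> continuous_on S h"
| "Ck_on (Suc k) S h \<longleftrightarrow>
     (\<forall>x\<in>S. h differentiable (at x)) \<and>
     (\<forall>v. Ck_on k S (\<lambda>x. frechet_derivative h (at x) v))"

definition smooth_on :: "'a::real_normed_vector set \<Rightarrow> ('a \<Rightarrow> 'b::real_normed_vector) \<Rightarrow> bool" where
  "smooth_on S h \<longleftrightarrow> (\<forall>k. Ck_on k S h)"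

definition pderiv_at :: "'n \<Rightarrow> (real^'n::finite \<Rightarrow> real) \<Rightarrow> real^'n \<Rightarrow> real" where
  "pderiv_at i h y = frechet_derivative h (at y) (axis i 1)"


section \<open>Riemannian manifolds\<close>

text \<open>A chart is a pair (domain, coordinate map); the values of the map off the domain play no
  role.  The dimension is \<open>CARD('n)\<close>.  The atlas need not be maximal.  The metric is the
  \<open>(0,2)\<close>-tensor field whose components in the chart \<open>c\<close>, at the point with coordinates \<open>y\<close>, are
  the entries of the matrix \<open>metric M c y\<close>.\<close>

type_synonym ('a, 'n) chart = "'a set \<times> ('a \<Rightarrow> real^'n)"

record ('a, 'n) riem_data =
  top_space :: "'a topology"
  atlas :: "('a, 'n) chart set"
  metric :: "('a, 'n) chart \<Rightarrow> real^'n \<Rightarrow> real^'n^'n"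

abbreviation points :: "('a, 'n::finite) riem_data \<Rightarrow> 'a set" where
  "points M \<equiv> topspace (top_space M)"

abbreviation chart_dom :: "('a, 'n::finite) chart \<Rightarrow> 'a set" where
  "chart_dom c \<equiv> fst c"

abbreviation coords :: "('a, 'n::finite) chart \<Rightarrow> 'a \<Rightarrow> real^'n" where
  "coords c \<equiv> snd c"

abbreviation chart_ran :: "('a, 'n::finite) chart \<Rightarrow> (real^'n) set" where
  "chart_ran c \<equiv> coords c ` chart_dom c"

definition chart_inv :: "('a, 'n::finite) chart \<Rightarrow> real^'n \<Rightarrow> 'a" where
  "chart_inv c = inv_into (chart_dom c) (coords c)"

definition transition :: "('a, 'n::finite) chart \<Rightarrow> ('a, 'n) chart \<Rightarrow> real^'n \<Rightarrow> real^'n" where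
  "transition c c' = coords c' \<circ> chart_inv c"

definition is_chart :: "'a topology \<Rightarrow> ('a, 'n::finite) chart \<Rightarrow> bool" where
  "is_chart X c \<longleftrightarrow>
     openin X (chart_dom c) \<and> open (chart_ran c) \<and>
     homeomorphic_map (subtopology X (chart_dom c)) (top_of_set (chart_ran c)) (coords c)"

definition smooth_manifold :: "('a, 'n::finite) riem_data \<Rightarrow> bool" where
  "smooth_manifold M \<longleftrightarrow>
     Hausdorff_space (top_space M) \<and> second_countable (top_space M) \<and>
     (\<forall>c\<in>atlas M. is_chart (top_space M) c) \<and>
     points M = (\<Union>c\<in>atlas M. chart_dom c) \<and>
     (\<forall>c\<in>atlas M. \<forall>c'\<in>atlas M.
        smooth_on (coords c ` (chart_dom c \<inter> chart_dom c')) (transition c c'))"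

definition riemannian_metric :: "('a, 'n::finite) riem_data \<Rightarrow> bool" where
  "riemannian_metric M \<longleftrightarrow>
     (\<forall>c\<in>atlas M.
        smooth_on (chart_ran c) (metric M c) \<and>
        (\<forall>y\<in>chart_ran c. transpose (metric M c y) = metric M c y \<and>
           (\<forall>v. v \<noteq> 0 \<longrightarrow> v \<bullet> (metric M c y *v v) > 0))) \<and>
     (\<forall>c\<in>atlas M. \<forall>c'\<in>atlas M. \<forall>p\<in>chart_dom c \<inter> chart_dom c'.
        let J = matrix (frechet_derivative (transition c c') (at (coords c p)))
        in metric M c (coords c p) = transpose J ** metric M c' (coords c' p) ** J)"

definition riemannian_manifold :: "('a, 'n::finite) riem_data \<Rightarrow> bool" where
  "riemannian_manifold M \<longleftrightarrow> smooth_manifold M \<and> riemannian_metric M"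

definition smooth_function :: "('a, 'n::finite) riem_data \<Rightarrow> ('a \<Rightarrow> real) \<Rightarrow> bool" where
  "smooth_function M f \<longleftrightarrow> (\<forall>c\<in>atlas M. smooth_on (chart_ran c) (f \<circ> chart_inv c))"

text \<open>An arbitrary chart around \<open>p\<close>, used for quantities that do not depend on the chart.\<close>

definition chart_at :: "('a, 'n::finite) riem_data \<Rightarrow> 'a \<Rightarrow> ('a, 'n) chart" where
  "chart_at M p = (SOME c. c \<in> atlas M \<and> p \<in> chart_dom c)"


section \<open>Levi-Civita connection, scalar curvature, Hessian\<close>

definition inv_metric :: "('a, 'n::finite) riem_data \<Rightarrow> ('a, 'n) chart \<Rightarrow> real^'n \<Rightarrow> real^'n^'n" where
  "inv_metric M c y = matrix_inv (metric M c y)"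

text \<open>\<open>christoffel M c k i j\<close> is \<open>\<Gamma>\<^sup>k\<^sub>i\<^sub>j\<close>.\<close>

definition christoffel ::
  "('a, 'n::finite) riem_data \<Rightarrow> ('a, 'n) chart \<Rightarrow> 'n \<Rightarrow> 'n \<Rightarrow> 'n \<Rightarrow> real^'n \<Rightarrow> real" where
  "christoffel M c k i j y =
     1/2 * (\<Sum>l\<in>UNIV. inv_metric M c y $ k $ l *
        (pderiv_at i (\<lambda>z. metric M c z $ j $ l) y
         + pderiv_at j (\<lambda>z. metric M c z $ i $ l) y
         - pderiv_at l (\<lambda>z. metric M c z $ i $ j) y))"

text \<open>\<open>curvature M c l i j k\<close> is the \<open>l\<close>-th component of
  \<open>R(\<partial>\<^sub>i, \<partial>\<^sub>j) \<partial>\<^sub>k = \<nabla>\<^sub>i \<nabla>\<^sub>j \<partial>\<^sub>k - \<nabla>\<^sub>j \<nabla>\<^sub>i \<partial>\<^sub>k\<close>, and \<open>Ric(Y, Z)\<close> is the trace of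
  \<open>X \<mapsto> R(X, Y) Z\<close>, so round spheres have positive scalar curvature.\<close>

definition curvature ::
  "('a, 'n::finite) riem_data \<Rightarrow> ('a, 'n) chart \<Rightarrow> 'n \<Rightarrow> 'n \<Rightarrow> 'n \<Rightarrow> 'n \<Rightarrow> real^'n \<Rightarrow> real" where
  "curvature M c l i j k y =
     pderiv_at i (christoffel M c l j k) y - pderiv_at j (christoffel M c l i k) y
     + (\<Sum>m\<in>UNIV. christoffel M c l i m y * christoffel M c m j k y
                  - christoffel M c l j m y * christoffel M c m i k y)"

definition ricci ::
  "('a, 'n::finite) riem_data \<Rightarrow> ('a, 'n) chart \<Rightarrow> 'n \<Rightarrow> 'n \<Rightarrow> real^'n \<Rightarrow> real" where
  "ricci M c j k y = (\<Sum>i\<in>UNIV. curvature M c i i j k y)"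

definition metric_trace ::
  "('a, 'n::finite) riem_data \<Rightarrow> ('a, 'n) chart \<Rightarrow> real^'n \<Rightarrow> ('n \<Rightarrow> 'n \<Rightarrow> real) \<Rightarrow> real" where
  "metric_trace M c y T = (\<Sum>i\<in>UNIV. \<Sum>j\<in>UNIV. inv_metric M c y $ i $ j * T i j)"

definition scalar_curvature :: "('a, 'n::finite) riem_data \<Rightarrow> 'a \<Rightarrow> real" where
  "scalar_curvature M p =
     (let c = chart_at M p; y = coords c p in metric_trace M c y (\<lambda>j k. ricci M c j k y))"

text \<open>The component \<open>(\<nabla>\<^sup>2 f)(\<partial>\<^sub>i, \<partial>\<^sub>j)\<close> in the chart \<open>c\<close>.\<close>

definition hessian ::
  "('a, 'n::finite) riem_data \<Rightarrow> ('a, 'n) chart \<Rightarrow> ('a \<Rightarrow> real) \<Rightarrow> 'n \<Rightarrow> 'n \<Rightarrow> real^'n \<Rightarrow> real" where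
  "hessian M c f i j y =
     pderiv_at i (pderiv_at j (f \<circ> chart_inv c)) y
     - (\<Sum>k\<in>UNIV. christoffel M c k i j y * pderiv_at k (f \<circ> chart_inv c) y)"

definition laplacian :: "('a, 'n::finite) riem_data \<Rightarrow> ('a \<Rightarrow> real) \<Rightarrow> 'a \<Rightarrow> real" where
  "laplacian M f p =
     (let c = chart_at M p; y = coords c p in metric_trace M c y (\<lambda>i j. hessian M c f i j y))"

definition subharmonic :: "('a, 'n::finite) riem_data \<Rightarrow> ('a \<Rightarrow> real) \<Rightarrow> bool" where
  "subharmonic M f \<longleftrightarrow> (\<forall>p\<in>points M. laplacian M f p \<ge> 0)"


section \<open>Riemannian distance\<close>

text \<open>\<open>C\<^sup>1\<close> on the closed interval, with one-sided derivatives at the end points.\<close>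

definition C1_curve_on :: "('a, 'n::finite) riem_data \<Rightarrow> real \<Rightarrow> real \<Rightarrow> (real \<Rightarrow> 'a) \<Rightarrow> bool" where
  "C1_curve_on M a b \<gamma> \<longleftrightarrow>
     (\<forall>c\<in>atlas M. let T = {t\<in>{a..b}. \<gamma> t \<in> chart_dom c} in
        (\<forall>t\<in>T. (coords c \<circ> \<gamma>) differentiable (at t within {a..b})) \<and>
        continuous_on T (\<lambda>t. vector_derivative (coords c \<circ> \<gamma>) (at t within {a..b})))"

definition piecewise_C1_curves :: "('a, 'n::finite) riem_data \<Rightarrow> 'a \<Rightarrow> 'a \<Rightarrow> (real \<Rightarrow> 'a) set" where
  "piecewise_C1_curves M p q =
     {\<gamma>. \<gamma> 0 = p \<and> \<gamma> 1 = q \<and>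
         continuous_map (top_of_set {0..1}) (top_space M) \<gamma> \<and>
         (\<exists>S. finite S \<and> {0, 1} \<subseteq> S \<and> S \<subseteq> {0..1} \<and>
            (\<forall>a\<in>S. \<forall>b\<in>S. a < b \<and> {a<..<b} \<inter> S = {} \<longrightarrow> C1_curve_on M a b \<gamma>))}"

definition speed :: "('a, 'n::finite) riem_data \<Rightarrow> (real \<Rightarrow> 'a) \<Rightarrow> real \<Rightarrow> real" where
  "speed M \<gamma> t =
     (let c = chart_at M (\<gamma> t); v = vector_derivative (coords c \<circ> \<gamma>) (at t)
      in sqrt (v \<bullet> (metric M c (coords c (\<gamma> t)) *v v)))"

definition curve_length :: "('a, 'n::finite) riem_data \<Rightarrow> (real \<Rightarrow> 'a) \<Rightarrow> real" where
  "curve_length M \<gamma> = integral {0..1} (speed M \<gamma>)"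

definition riem_dist :: "('a, 'n::finite) riem_data \<Rightarrow> 'a \<Rightarrow> 'a \<Rightarrow> real" where
  "riem_dist M p q = (INF \<gamma>\<in>piecewise_C1_curves M p q. curve_length M \<gamma>)"

definition riem_ball :: "('a, 'n::finite) riem_data \<Rightarrow> 'a \<Rightarrow> real \<Rightarrow> 'a set" where
  "riem_ball M q r = {x\<in>points M. riem_dist M x q < r}"


section \<open>Riemannian volume and integration\<close>

definition is_riem_volume :: "('a, 'n::finite) riem_data \<Rightarrow> 'a measure \<Rightarrow> bool" where
  "is_riem_volume M \<mu> \<longleftrightarrow>
     space \<mu> = points M \<and>
     sets \<mu> = sigma_sets (points M) {U. openin (top_space M) U} \<and>
     (\<forall>c\<in>atlas M. \<forall>E\<in>sets \<mu>. E \<subseteq> chart_dom c \<longrightarrow>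
        emeasure \<mu> E = (\<integral>\<^sup>+y\<in>coords c ` E. ennreal (sqrt (det (metric M c y))) \<partial>lborel))"

text \<open>On a Riemannian manifold there is exactly one such Borel measure: the local formulas agree on
  overlaps by the change of variables formula, and countably many chart domains cover.\<close>

definition riem_volume :: "('a, 'n::finite) riem_data \<Rightarrow> 'a measure" where
  "riem_volume M = (THE \<mu>. is_riem_volume M \<mu>)"

text \<open>The extended-real Lebesgue integral of a real function \<open>h\<close> of either sign, as the integral of
  \<open>h\<^sup>+\<close> minus that of \<open>h\<^sup>-\<close> (\<^const>\<open>ennreal\<close> sends negative reals to \<open>0\<close>).  Since \<open>\<infinity> - \<infinity> = \<infinity>\<close> in
  \<^typ>\<open>ereal\<close>, the integral is \<open>< \<infinity>\<close> exactly if it exists in \<open>[-\<infinity>, \<infinity>]\<close> and is not \<open>\<infinity>\<close>.\<close>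

definition ext_integral :: "'a measure \<Rightarrow> 'a set \<Rightarrow> ('a \<Rightarrow> real) \<Rightarrow> ereal" where
  "ext_integral \<mu> A h =
     enn2ereal (\<integral>\<^sup>+x\<in>A. ennreal (h x) \<partial>\<mu>) - enn2ereal (\<integral>\<^sup>+x\<in>A. ennreal (- h x) \<partial>\<mu>)"


section \<open>Gradient Yamabe solitons\<close>

definition gradient_yamabe_soliton ::
  "('a, 'n::finite) riem_data \<Rightarrow> ('a \<Rightarrow> real) \<Rightarrow> real \<Rightarrow> bool" where
  "gradient_yamabe_soliton M f lam \<longleftrightarrow>
     riemannian_manifold M \<and> CARD('n) \<ge> 2 \<and> connected_space (top_space M) \<and>
     smooth_function M f \<and>
     (\<forall>c\<in>atlas M. \<forall>p\<in>chart_dom c. \<forall>i j.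
        hessian M c f i j (coords c p) =
          (scalar_curvature M p - lam) * metric M c (coords c p) $ i $ j)"

end

theory Submission
  imports Defs
begin

text \<open>The trace of the soliton equation \<open>\<nabla>\<^sup>2 f = (R - \<lambda>) g\<close> with respect to \<open>g\<close> is
  \<open>\<Delta>f = n (R - \<lambda>)\<close>, because \<open>g\<close> itself has trace \<open>n\<close>: this is the identity
  \<open>g\<^sup>i\<^sup>j g\<^sub>j\<^sub>i = n\<close>, valid since a positive definite symmetric matrix is invertible
  (\<open>metric_trace_of_conformal_metric\<close>).  With \<open>R \<ge> 0\<close> and \<open>\<lambda> \<le> 0\<close> the right-hand side is
  non-negative at every point.\<close>

text \<open>A vector in the kernel of \<open>A\<close> has \<open>v \<bullet> A v = 0\<close>, so the kernel is trivial; for a square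
  matrix this gives invertibility.\<close>

lemma invertible_if_positive_definite:
  fixes A :: "real^'n^'n"
  assumes "\<And>v. v \<noteq> 0 \<Longrightarrow> v \<bullet> (A *v v) > 0"
  shows "invertible A"
proof -
  have "v = 0" if "A *v v = 0" for v
    using assms[of v] that by fastforce
  then show ?thesis
    by (simp add: invertible_left_inverse matrix_left_invertible_ker)
qed

lemma metric_trace_of_conformal_metric:
  fixes M :: "('a, 'n::finite) riem_data"
  assumes metric: "riemannian_metric M" and c: "c \<in> atlas M" and y: "y \<in> chart_ran c"
  shows "metric_trace M c y (\<lambda>i j. s * metric M c y $ i $ j) = real CARD('n) * s"
proof -
  let ?g = "metric M c y"
  have symmetric: "transpose ?g = ?g" and positive: "v \<noteq> 0 \<Longrightarrow> v \<bullet> (?g *v v) > 0" for v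
    using metric[unfolded riemannian_metric_def, THEN conjunct1, rule_format, OF c] y by auto
  have "inv_metric M c y ** ?g = mat 1"
    using someI_ex[OF invertible_if_positive_definite[OF positive, unfolded invertible_def]]
    unfolding inv_metric_def matrix_inv_def by blast
  then have diagonal: "(\<Sum>j\<in>UNIV. inv_metric M c y $ i $ j * ?g $ j $ i) = 1" for i
    by (simp add: matrix_matrix_mult_def mat_def vec_eq_iff)
  have entries_symmetric: "?g $ i $ j = ?g $ j $ i" for i j
    by (metis symmetric transpose_def vec_lambda_beta)
  have "metric_trace M c y (\<lambda>i j. s * ?g $ i $ j)
      = (\<Sum>i\<in>UNIV. s * (\<Sum>j\<in>UNIV. inv_metric M c y $ i $ j * ?g $ j $ i))"
    unfolding metric_trace_def sum_distrib_left
    by (simp add: entries_symmetric mult.left_commute)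
  then show ?thesis
    by (simp add: diagonal)
qed

lemma chart_at_chart:
  assumes "smooth_manifold M" and "p \<in> points M"
  shows "chart_at M p \<in> atlas M" and "p \<in> chart_dom (chart_at M p)"
proof -
  have "\<exists>c. c \<in> atlas M \<and> p \<in> chart_dom c"
    using assms unfolding smooth_manifold_def by blast
  then have "chart_at M p \<in> atlas M \<and> p \<in> chart_dom (chart_at M p)"
    unfolding chart_at_def by (rule someI_ex)
  then show "chart_at M p \<in> atlas M" and "p \<in> chart_dom (chart_at M p)" by auto
qed

lemma laplacian_of_gradient_yamabe_soliton:
  fixes M :: "('a, 'n::finite) riem_data"
  assumes soliton: "gradient_yamabe_soliton M f lam" and p: "p \<in> points M"
  shows "laplacian M f p = real CARD('n) * (scalar_curvature M p - lam)"
proof -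
  let ?c = "chart_at M p"
  have manifold: "smooth_manifold M" and metric: "riemannian_metric M"
    using soliton unfolding gradient_yamabe_soliton_def riemannian_manifold_def by auto
  note chart = chart_at_chart[OF manifold p]
  have "hessian M ?c f i j (coords ?c p)
      = (scalar_curvature M p - lam) * metric M ?c (coords ?c p) $ i $ j" for i j
    using soliton chart unfolding gradient_yamabe_soliton_def by blast
  then show ?thesis
    using metric_trace_of_conformal_metric[OF metric chart(1) imageI[OF chart(2)]]
    by (simp add: laplacian_def Let_def)
qed

theorem theorem2p1:
  fixes M :: "('a, 'n::finite) riem_data" and f :: "'a \<Rightarrow> real" and lam r :: real and q :: 'a
  assumes dim: "CARD('n) \<ge> 2"
    and soliton: "gradient_yamabe_soliton M f lam"
    and expanding_or_steady: "lam < 0 \<or> lam = 0"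
    and scal_nonneg: "\<forall>p\<in>points M. scalar_curvature M p \<ge> 0"
    and q: "q \<in> points M" and r: "r > 0"
    and finite_integral:
      "ext_integral (riem_volume M) (points M - riem_ball M q r)
         (\<lambda>x. f x / (riem_dist M x q)\<^sup>2) < \<infinity>"
  shows "subharmonic M f"
proof -
  have "laplacian M f p \<ge> 0" if p: "p \<in> points M" for p
    using laplacian_of_gradient_yamabe_soliton[OF soliton p] scal_nonneg expanding_or_steady p
    by auto
  then show ?thesis
    unfolding subharmonic_def by blast
qed

end
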